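(* Let $n\ge2$ be an integer. For $R>0$ let $(x_R(t),r_R(t),\theta_R(t))$ be the solution of $$\dot x=\cos\theta,\qquad \dot r=\sin\theta,\qquad \dot\theta=\Big(\frac{n-1}{r}-\frac r2\Big)\cos\theta+\frac x2\sin\theta$$ with $x(0)=0$, $r(0)=R$, $\theta(0)=0$, and regard $\theta_R$ as a function of $r$, and the curve as a graph $x=g_R(r)$, along the branch starting from the point $(0,R)$ and going into $x>0$ with $r$ decreasing. Then, as $R\to+\infty$, $\theta_R\big(R-\frac1R\big)$ converges to a fixed negative constant $\theta_1$. Moreover, there exist constants $C_1,C_2>0$, depending only on $n$, such that for all sufficiently large $R$ $$\frac{C_1}{R}\le g_R\Big(R-\frac1R\Big)\le\frac{C_2}{R}.$$
   Context: The system is that of arc-length parametrized profile curves of rotationally symmetric self-shrinkers in $\mathbb R^{n+1}$ (rotation about the $x$-axis), where $\theta$ is the angle between the tangent direction of the curve and the positive $x$-direction. *)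

theory Defs
  imports "HOL-Analysis.Analysis"
begin

text \<open>The phase space is the half space \<open>r > 0\<close>, where the vector field is smooth.\<close>

definition profile_solution ::
  "nat \<Rightarrow> real \<Rightarrow> real set \<Rightarrow> (real \<Rightarrow> real) \<Rightarrow> (real \<Rightarrow> real) \<Rightarrow> (real \<Rightarrow> real) \<Rightarrow> bool" where
  "profile_solution n R J x r \<theta> \<longleftrightarrow>
     open J \<and> is_interval J \<and> 0 \<in> J \<and>
     x 0 = 0 \<and> r 0 = R \<and> \<theta> 0 = 0 \<and>
     (\<forall>t\<in>J. 0 < r t \<and>
        (x has_real_derivative cos (\<theta> t)) (at t) \<and>
        (r has_real_derivative sin (\<theta> t)) (at t) \<and>
        (\<theta> has_real_derivative
           ((real n - 1) / r t - r t / 2) * cos (\<theta> t) + x t / 2 * sin (\<theta> t)) (at t))"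

text \<open>
  The maximal solution, as the union of all solutions on open intervals around \<open>0\<close>.
  The description below is proper for \<open>t\<close> in the maximal interval, since the
  initial value problem has unique solutions; elsewhere the value is irrelevant.
\<close>

definition profile_ivl :: "nat \<Rightarrow> real \<Rightarrow> real set" where
  "profile_ivl n R = {t. \<exists>J x r \<theta>. profile_solution n R J x r \<theta> \<and> t \<in> J}"

definition profile_flow :: "nat \<Rightarrow> real \<Rightarrow> real \<Rightarrow> real \<times> real \<times> real" where
  "profile_flow n R t =
     (THE p. \<exists>J x r \<theta>. profile_solution n R J x r \<theta> \<and> t \<in> J \<and> p = (x t, r t, \<theta> t))"

definition profile_x :: "nat \<Rightarrow> real \<Rightarrow> real \<Rightarrow> real" where
  "profile_x n R t = fst (profile_flow n R t)"

definition profile_r :: "nat \<Rightarrow> real \<Rightarrow> real \<Rightarrow> real" where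
  "profile_r n R t = fst (snd (profile_flow n R t))"

definition profile_theta :: "nat \<Rightarrow> real \<Rightarrow> real \<Rightarrow> real" where
  "profile_theta n R t = snd (snd (profile_flow n R t))"

text \<open>
  The parameters of the branch that starts at \<open>(0, R)\<close> and goes into \<open>x > 0\<close> with \<open>r\<close>
  decreasing. On it \<open>r\<close> is injective, so \<open>r\<close> can serve as the independent variable;
  \<open>branch_time n R \<rho>\<close> is meaningful for \<open>\<rho> \<in> branch_radii n R\<close>.
\<close>

definition branch :: "nat \<Rightarrow> real \<Rightarrow> real set" where
  "branch n R =
     {t \<in> profile_ivl n R. 0 \<le> t \<and> strict_antimono_on {0..t} (profile_r n R) \<and>
        (\<forall>s\<in>{0<..t}. 0 < profile_x n R s)}"

definition branch_radii :: "nat \<Rightarrow> real \<Rightarrow> real set" where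
  "branch_radii n R = profile_r n R ` branch n R"

definition branch_time :: "nat \<Rightarrow> real \<Rightarrow> real \<Rightarrow> real" where
  "branch_time n R = the_inv_into (branch n R) (profile_r n R)"

definition branch_theta :: "nat \<Rightarrow> real \<Rightarrow> real \<Rightarrow> real" where
  "branch_theta n R \<rho> = profile_theta n R (branch_time n R \<rho>)"

definition branch_graph :: "nat \<Rightarrow> real \<Rightarrow> real \<Rightarrow> real" where
  "branch_graph n R \<rho> = profile_x n R (branch_time n R \<rho>)"

end

theory Submission
  imports Defs
begin

text \<open>
  On the scale \<open>1 / R\<close> the profile curve is a small perturbation of the grim reaper. Writing
  \<open>x = X / R\<close>, \<open>r = R + \<rho> / R\<close>, \<open>t = s / R\<close>, \<open>\<epsilon> = 1 / R\<^sup>2\<close> and \<open>\<theta> = arctan (sinh w)\<close>, so that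
  \<open>cos \<theta> = 1 / cosh w\<close> and \<open>sin \<theta> = tanh w\<close>, the system becomes
  \<open>X' = 1 / cosh w\<close>, \<open>\<rho>' = tanh w\<close> and
  \<open>w' = - 1 / 2 + \<epsilon> ((n - 1) / (1 + \<epsilon> \<rho>) - \<rho> / 2 + X / 2 sinh w)\<close>.
  For small \<open>\<epsilon>\<close> the integral operator for \<open>w\<close> is a contraction on a fixed time interval, which
  gives the solution there together with \<open>w = - s / 2 + O(\<epsilon>)\<close> and
  \<open>\<rho> = - 2 ln (cosh (s / 2)) + O(\<epsilon>)\<close>. Hence \<open>\<rho> = - 1\<close> is reached at a time \<open>s\<close> tending to
  \<open>2 arcosh (exp (1 / 2))\<close>, the angle tends to \<open>- arctan (sinh (arcosh (exp (1 / 2))))\<close>, and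
  \<open>X\<close> lies between positive constants.
\<close>

subsection \<open>Elementary estimates\<close>

lemma abs_diff_le_of_deriv:
  fixes f f' :: "real \<Rightarrow> real"
  assumes "\<And>x. (f has_real_derivative f' x) (at x)" "\<And>x. \<bar>f' x\<bar> \<le> 1"
  shows "\<bar>f a - f b\<bar> \<le> \<bar>a - b\<bar>"
  using field_differentiable_bound[of UNIV f f' 1 a b] assms by simp

lemma abs_sin_diff_le: "\<bar>sin a - sin b\<bar> \<le> \<bar>a - b\<bar>" for a b :: real
  by (rule abs_diff_le_of_deriv[of _ cos]) auto

lemma abs_cos_diff_le: "\<bar>cos a - cos b\<bar> \<le> \<bar>a - b\<bar>" for a b :: real
  by (rule abs_diff_le_of_deriv[of _ "\<lambda>x. - sin x"]) (auto intro!: derivative_eq_intros)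

lemma abs_tanh_diff_le: "\<bar>tanh a - tanh b\<bar> \<le> \<bar>a - b\<bar>" for a b :: real
proof (rule abs_diff_le_of_deriv[of _ "\<lambda>x. 1 - tanh x ^ 2"])
  fix x :: real
  have "tanh x ^ 2 < 1"
    using tanh_real_bounds[of x] by (simp add: abs_square_less_1 abs_if)
  then show "\<bar>1 - tanh x ^ 2\<bar> \<le> 1" by simp
qed (auto intro!: derivative_eq_intros)

lemma abs_sinh_le_cosh: "\<bar>sinh x\<bar> \<le> cosh x" for x :: real
  by (auto simp: sinh_field_def cosh_field_def abs_le_iff)

lemma abs_sech_diff_le: "\<bar>1 / cosh a - 1 / cosh b\<bar> \<le> \<bar>a - b\<bar>" for a b :: real
proof (rule abs_diff_le_of_deriv[of _ "\<lambda>x. - (sinh x / (cosh x)\<^sup>2)"])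
  fix x :: real
  have "\<bar>sinh x\<bar> \<le> cosh x * cosh x"
    using abs_sinh_le_cosh[of x] mult_right_mono[of 1 "cosh x" "cosh x"] cosh_real_ge_1[of x] by linarith
  then show "\<bar>- (sinh x / (cosh x)\<^sup>2)\<bar> \<le> 1" by (simp add: power2_eq_square)
qed (auto intro!: derivative_eq_intros simp: power2_eq_square)

lemma cosh_le_cosh_abs: "\<bar>x\<bar> \<le> B \<Longrightarrow> cosh x \<le> cosh B" for x B :: real
  using cosh_real_nonneg_le_iff[of "\<bar>x\<bar>" B] by simp

text \<open>Unlike \<open>sin\<close>, \<open>cos\<close>, \<open>tanh\<close> and
  \<open>1 / cosh\<close>, the function \<open>sinh\<close> is not globally Lipschitz. The constant
  therefore depends on an a priori bound \<open>B\<close>, and this is why the fixed point argument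
  below works in a ball.\<close>

lemma abs_sinh_diff_le:
  fixes a b B :: real
  assumes "\<bar>a\<bar> \<le> B" "\<bar>b\<bar> \<le> B"
  shows "\<bar>sinh a - sinh b\<bar> \<le> cosh B * \<bar>a - b\<bar>"
proof -
  have "norm (sinh a - sinh b) \<le> cosh B * norm (a - b)"
  proof (rule field_differentiable_bound)
    fix z :: real assume "z \<in> {-B..B}"
    then have "\<bar>z\<bar> \<le> B" by auto
    then show "norm (cosh z) \<le> cosh B" by (simp add: cosh_le_cosh_abs)
  qed (use assms in \<open>auto intro!: derivative_eq_intros\<close>)
  then show ?thesis by simp
qed

lemma abs_add3_le:
  fixes a b c :: real
  shows "\<bar>a\<bar> \<le> A \<Longrightarrow> \<bar>b\<bar> \<le> B \<Longrightarrow> \<bar>c\<bar> \<le> C \<Longrightarrow> \<bar>a - b + c\<bar> \<le> A + B + C"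
  by linarith

lemma abs_add4_le:
  fixes a b c d :: real
  shows "\<bar>a\<bar> \<le> A \<Longrightarrow> \<bar>b\<bar> \<le> B \<Longrightarrow> \<bar>c\<bar> \<le> C \<Longrightarrow> \<bar>d\<bar> \<le> D \<Longrightarrow> \<bar>a + b + c + d\<bar> \<le> A + B + C + D"
  by linarith

lemma abs_increment_le:
  fixes f f' :: "real \<Rightarrow> real"
  assumes "0 \<le> s" and d: "\<And>u. u \<in> {0..s} \<Longrightarrow> (f has_real_derivative f' u) (at u)"
    and B: "\<And>u. u \<in> {0..s} \<Longrightarrow> \<bar>f' u\<bar> \<le> B"
  shows "\<bar>f s - f 0\<bar> \<le> B * s"
proof -
  have "norm (f s - f 0) \<le> B * norm (s - 0)"
  proof (rule field_differentiable_bound[where S = "{0..s}" and f' = f'])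
    show "(f has_real_derivative f' u) (at u within {0..s})" if "u \<in> {0..s}" for u
      using d[OF that] by (rule has_field_derivative_at_within)
    show "norm (f' u) \<le> B" if "u \<in> {0..s}" for u
      using B[OF that] by simp
  qed (use \<open>0 \<le> s\<close> in auto)
  then show ?thesis using \<open>0 \<le> s\<close> by simp
qed

subsection \<open>Uniqueness\<close>

text \<open>Multiplying by the integrating factor \<open>exp (- (C * s))\<close> turns the
  differential inequality into monotonicity: the product has nonpositive derivative and starts at 0,
  while \<open>E\<close> is nonnegative.\<close>

lemma gronwall_zero:
  fixes E E' :: "real \<Rightarrow> real"
  assumes "0 \<le> t" "E 0 = 0" "\<And>s. 0 \<le> E s"
    and "\<And>s. s \<in> {0..t} \<Longrightarrow> (E has_real_derivative E' s) (at s)"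
    and "\<And>s. s \<in> {0..t} \<Longrightarrow> E' s \<le> C * E s"
  shows "E t = 0"
proof -
  have "exp (- (C * t)) * E t \<le> exp (- (C * 0)) * E 0"
  proof (rule DERIV_nonpos_imp_nonincreasing[OF \<open>0 \<le> t\<close>])
    fix s assume s: "0 \<le> s" "s \<le> t"
    have "((\<lambda>s. exp (- (C * s)) * E s) has_real_derivative exp (- (C * s)) * (E' s - C * E s)) (at s)"
      using s by (auto intro!: derivative_eq_intros assms(4) simp: algebra_simps)
    moreover have "exp (- (C * s)) * (E' s - C * E s) \<le> 0"
      using assms(5)[of s] s by (simp add: mult_le_0_iff)
    ultimately show "\<exists>y. ((\<lambda>s. exp (- (C * s)) * E s) has_real_derivative y) (at s) \<and> y \<le> 0"
      by blast
  qed
  then show ?thesis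
    using assms(2) assms(3)[of t] by (simp add: mult_le_0_iff)
qed

text \<open>The products are telescoped so that a difference of trigonometric values is always
  multiplied by a coefficient taken at the second point. Hence \<open>M\<close> bounds only
  \<open>r2\<close> and \<open>x2\<close>, while the lower bound \<open>m\<close> on both radii
  controls \<open>k / r\<close>.\<close>

lemma profile_vector_field_lipschitz:
  fixes k m M x1 x2 r1 r2 \<theta>1 \<theta>2 :: real
  assumes "0 \<le> k" "0 < m" "m \<le> r1" "m \<le> r2" "\<bar>r2\<bar> \<le> M" "\<bar>x2\<bar> \<le> M"
  shows "\<bar>((k / r1 - r1 / 2) * cos \<theta>1 + x1 / 2 * sin \<theta>1) -
          ((k / r2 - r2 / 2) * cos \<theta>2 + x2 / 2 * sin \<theta>2)\<bar>
    \<le> (k / (m * m) + k / m + M + 1) * (\<bar>x1 - x2\<bar> + \<bar>r1 - r2\<bar> + \<bar>\<theta>1 - \<theta>2\<bar>)"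
proof -
  let ?A = "\<lambda>r. k / r - r / 2"
  have M: "0 \<le> M" using assms by linarith
  have "k / r1 - k / r2 = k * (r2 - r1) / (r1 * r2)"
    using assms by (simp add: field_simps)
  then have "\<bar>k / r1 - k / r2\<bar> = k * \<bar>r1 - r2\<bar> / (r1 * r2)"
    using assms by (simp add: abs_mult abs_minus_commute)
  also have "\<dots> \<le> k * \<bar>r1 - r2\<bar> / (m * m)"
    using assms by (intro divide_left_mono mult_mono mult_pos_pos mult_nonneg_nonneg) auto
  finally have A: "\<bar>?A r1 - ?A r2\<bar> \<le> (k / (m * m) + 1) * \<bar>r1 - r2\<bar>"
    by (simp add: algebra_simps)
  have "k / r2 \<le> k / m" "0 \<le> k / r2"
    using assms by (auto intro!: divide_left_mono mult_pos_pos)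
  then have A2: "\<bar>?A r2\<bar> \<le> k / m + M / 2" using assms by linarith
  have 1: "\<bar>(?A r1 - ?A r2) * cos \<theta>1\<bar> \<le> (k / (m * m) + 1) * \<bar>r1 - r2\<bar>"
    using mult_mono[OF A abs_cos_le_one[of \<theta>1]] assms by (simp add: abs_mult)
  have 2: "\<bar>?A r2 * (cos \<theta>1 - cos \<theta>2)\<bar> \<le> (k / m + M / 2) * \<bar>\<theta>1 - \<theta>2\<bar>"
    using mult_mono[OF A2 abs_cos_diff_le[of \<theta>1 \<theta>2]] assms M by (simp add: abs_mult)
  have 3: "\<bar>(x1 - x2) / 2 * sin \<theta>1\<bar> \<le> \<bar>x1 - x2\<bar>"
    using mult_mono[of "\<bar>(x1 - x2) / 2\<bar>" "\<bar>x1 - x2\<bar>" "\<bar>sin \<theta>1\<bar>" 1] by (simp add: abs_mult)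
  have 4: "\<bar>x2 / 2 * (sin \<theta>1 - sin \<theta>2)\<bar> \<le> M / 2 * \<bar>\<theta>1 - \<theta>2\<bar>"
    using mult_mono[OF _ abs_sin_diff_le[of \<theta>1 \<theta>2], of "\<bar>x2 / 2\<bar>" "M / 2"] assms M by (simp add: abs_mult)
  define L where "L = k / (m * m) + k / m + M + 1"
  have "0 \<le> k / (m * m)" "0 \<le> k / m" using assms by auto
  then have L: "1 \<le> L" "k / (m * m) + 1 \<le> L" "k / m + M \<le> L"
    using M by (auto simp: L_def)
  have "\<bar>(?A r1 * cos \<theta>1 + x1 / 2 * sin \<theta>1) - (?A r2 * cos \<theta>2 + x2 / 2 * sin \<theta>2)\<bar>
    = \<bar>(?A r1 - ?A r2) * cos \<theta>1 + ?A r2 * (cos \<theta>1 - cos \<theta>2)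
       + (x1 - x2) / 2 * sin \<theta>1 + x2 / 2 * (sin \<theta>1 - sin \<theta>2)\<bar>"
    by (simp add: algebra_simps diff_divide_distrib)
  also have "\<dots> \<le> (k / (m * m) + 1) * \<bar>r1 - r2\<bar> + (k / m + M / 2) * \<bar>\<theta>1 - \<theta>2\<bar>
       + \<bar>x1 - x2\<bar> + M / 2 * \<bar>\<theta>1 - \<theta>2\<bar>"
    using 1 2 3 4 by (rule abs_add4_le)
  also have "\<dots> = 1 * \<bar>x1 - x2\<bar> + (k / (m * m) + 1) * \<bar>r1 - r2\<bar> + (k / m + M) * \<bar>\<theta>1 - \<theta>2\<bar>"
    by (simp add: algebra_simps)
  also have "\<dots> \<le> L * \<bar>x1 - x2\<bar> + L * \<bar>r1 - r2\<bar> + L * \<bar>\<theta>1 - \<theta>2\<bar>"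
    using L by (intro add_mono mult_right_mono) auto
  finally show ?thesis by (simp add: distrib_left flip: L_def)
qed

text \<open>Gronwall's argument for the squared distance of two solutions, which is differentiable,
  unlike the sum of absolute values. Compactness of \<open>{0..t}\<close> keeps both radii away from
  the singularity at 0 and bounds the second solution. Nonnegative times suffice because
  \<open>branch\<close> contains no others.\<close>

lemma profile_solution_unique:
  assumes n: "1 \<le> n"
    and 1: "profile_solution n R J1 x1 r1 \<theta>1" and 2: "profile_solution n R J2 x2 r2 \<theta>2"
    and t: "0 \<le> t" "t \<in> J1" "t \<in> J2"
  shows "x1 t = x2 t \<and> r1 t = r2 t \<and> \<theta>1 t = \<theta>2 t"
proof -
  have sub: "{0..t} \<subseteq> J1" "{0..t} \<subseteq> J2"
    using 1 2 t unfolding profile_solution_def is_interval_1 by (meson atLeastAtMost_iff subsetI)+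
  note d1 = 1[unfolded profile_solution_def] and d2 = 2[unfolded profile_solution_def]
  have cont: "continuous_on {0..t} x2" "continuous_on {0..t} r1" "continuous_on {0..t} r2"
    using d1 d2 sub by (meson DERIV_isCont continuous_at_imp_continuous_on subsetD)+
  have pos: "0 < r1 s" "0 < r2 s" if "s \<in> {0..t}" for s
    using d1 d2 sub that by blast+
  obtain s1 s2 where s: "s1 \<in> {0..t}" "\<And>s. s \<in> {0..t} \<Longrightarrow> r1 s1 \<le> r1 s"
      "s2 \<in> {0..t}" "\<And>s. s \<in> {0..t} \<Longrightarrow> r2 s2 \<le> r2 s"
    using continuous_attains_inf[OF _ _ cont(2)] continuous_attains_inf[OF _ _ cont(3)] t
    by (metis atLeastatMost_empty_iff2 compact_Icc)
  define m where "m = min (r1 s1) (r2 s2)"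
  have m: "0 < m" "\<And>s. s \<in> {0..t} \<Longrightarrow> m \<le> r1 s" "\<And>s. s \<in> {0..t} \<Longrightarrow> m \<le> r2 s"
    using pos s unfolding m_def by (auto simp: min_le_iff_disj)
  have "bounded (x2 ` {0..t} \<union> r2 ` {0..t})"
    using cont by (simp add: compact_imp_bounded compact_continuous_image)
  then obtain M where M: "\<And>s. s \<in> {0..t} \<Longrightarrow> \<bar>x2 s\<bar> \<le> M" "\<And>s. s \<in> {0..t} \<Longrightarrow> \<bar>r2 s\<bar> \<le> M"
    unfolding bounded_iff by fastforce
  define k L where "k = real n - 1" and "L = k / (m * m) + k / m + M + 1"
  have k: "0 \<le> k" using n by (simp add: k_def)
  have "0 \<le> M" using M(1)[of 0] t by fastforce
  then have L: "0 \<le> L" using k m(1) by (simp add: L_def)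
  define F where "F x r \<theta> = (k / r - r / 2) * cos \<theta> + x / 2 * sin \<theta>" for x r \<theta> :: real
  define E where "E s = (x1 s - x2 s)\<^sup>2 + (r1 s - r2 s)\<^sup>2 + (\<theta>1 s - \<theta>2 s)\<^sup>2" for s
  define E' where "E' s = 2 * (x1 s - x2 s) * (cos (\<theta>1 s) - cos (\<theta>2 s))
      + 2 * (r1 s - r2 s) * (sin (\<theta>1 s) - sin (\<theta>2 s))
      + 2 * (\<theta>1 s - \<theta>2 s) * (F (x1 s) (r1 s) (\<theta>1 s) - F (x2 s) (r2 s) (\<theta>2 s))" for s
  have "E t = 0"
  proof (rule gronwall_zero[of t E E' "2 + 4 * L"])
    show "E 0 = 0" using d1 d2 by (simp add: E_def)
    show "0 \<le> E s" for s by (simp add: E_def)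
    fix s assume s: "s \<in> {0..t}"
    then have J: "s \<in> J1" "s \<in> J2" using sub by auto
    have D: "(x1 has_real_derivative cos (\<theta>1 s)) (at s)" "(x2 has_real_derivative cos (\<theta>2 s)) (at s)"
      "(r1 has_real_derivative sin (\<theta>1 s)) (at s)" "(r2 has_real_derivative sin (\<theta>2 s)) (at s)"
      "(\<theta>1 has_real_derivative F (x1 s) (r1 s) (\<theta>1 s)) (at s)"
      "(\<theta>2 has_real_derivative F (x2 s) (r2 s) (\<theta>2 s)) (at s)"
      using d1 d2 J by (auto simp: F_def k_def)
    show "(E has_real_derivative E' s) (at s)"
      unfolding E_def E'_def
      by (rule derivative_eq_intros D refl)+ (simp add: algebra_simps)
    define a b c where "a = \<bar>x1 s - x2 s\<bar>" and "b = \<bar>r1 s - r2 s\<bar>" and "c = \<bar>\<theta>1 s - \<theta>2 s\<bar>"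
    have F: "\<bar>F (x1 s) (r1 s) (\<theta>1 s) - F (x2 s) (r2 s) (\<theta>2 s)\<bar> \<le> L * (a + b + c)"
      using profile_vector_field_lipschitz[OF k m(1) m(2)[OF s] m(3)[OF s] M(2)[OF s] M(1)[OF s]]
      by (simp add: F_def L_def a_def b_def c_def)
    have "(x1 s - x2 s) * (cos (\<theta>1 s) - cos (\<theta>2 s)) \<le> a * c"
      unfolding a_def c_def by (rule order_trans[OF abs_ge_self])
        (auto simp: abs_mult intro: mult_mono abs_cos_diff_le)
    moreover have "(r1 s - r2 s) * (sin (\<theta>1 s) - sin (\<theta>2 s)) \<le> b * c"
      unfolding b_def c_def by (rule order_trans[OF abs_ge_self])
        (auto simp: abs_mult intro: mult_mono abs_sin_diff_le)
    moreover have "(\<theta>1 s - \<theta>2 s) * (F (x1 s) (r1 s) (\<theta>1 s) - F (x2 s) (r2 s) (\<theta>2 s)) \<le> c * (L * (a + b + c))"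
      by (rule order_trans[OF abs_ge_self]) (auto simp: abs_mult c_def intro!: mult_mono F[unfolded c_def])
    ultimately have "E' s \<le> 2 * (a * c) + 2 * (b * c) + 2 * (c * (L * (a + b + c)))"
      unfolding E'_def by linarith
    also have "\<dots> = (1 + L) * (2 * (a * c) + 2 * (b * c)) + 2 * L * c\<^sup>2"
      by (simp add: algebra_simps power2_eq_square)
    \<comment> \<open>Here 2ac <= a^2 + c^2 and 2bc <= b^2 + c^2. The resulting coefficient of c^2
      is 2(1 + L) + 2L, the source of the Gronwall constant \<open>2 + 4 * L\<close>.\<close>
    also have "\<dots> \<le> (1 + L) * (a\<^sup>2 + b\<^sup>2 + 2 * c\<^sup>2) + 2 * L * c\<^sup>2"
      using sum_squares_bound[of a c] sum_squares_bound[of b c] L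
      by (intro add_right_mono mult_left_mono) auto
    also have "\<dots> \<le> (2 + 4 * L) * (a\<^sup>2 + b\<^sup>2 + c\<^sup>2)"
      using L by (simp add: algebra_simps)
    finally show "E' s \<le> (2 + 4 * L) * E s" by (simp add: E_def a_def b_def c_def)
  qed (use t in auto)
  then show ?thesis
    unfolding E_def by (smt (verit) eq_iff_diff_eq_0 power2_eq_iff zero_le_power2 zero_eq_power2)
qed

text \<open>By uniqueness the definite description in \<open>profile_flow\<close> can be evaluated
  with any solution at hand. One solution on a short interval thus gives the flow there, and the
  maximal interval never has to be determined.\<close>

lemma profile_flow_eq:
  assumes "1 \<le> n" "profile_solution n R J x r \<theta>" "0 \<le> t" "t \<in> J"
  shows "profile_flow n R t = (x t, r t, \<theta> t)"
  unfolding profile_flow_def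
proof (rule the_equality)
  show "\<exists>J' x' r' \<theta>'. profile_solution n R J' x' r' \<theta>' \<and> t \<in> J' \<and> (x t, r t, \<theta> t) = (x' t, r' t, \<theta>' t)"
    using assms(2,4) by (intro exI conjI) (rule refl | assumption)+
  fix p assume "\<exists>J' x' r' \<theta>'. profile_solution n R J' x' r' \<theta>' \<and> t \<in> J' \<and> p = (x' t, r' t, \<theta>' t)"
  then obtain J' x' r' \<theta>' where "profile_solution n R J' x' r' \<theta>'" "t \<in> J'" and p: "p = (x' t, r' t, \<theta>' t)"
    by (elim exE conjE)
  from profile_solution_unique[OF assms(1) this(1) assms(2,3) this(2) assms(4)]
  show "p = (x t, r t, \<theta> t)" by (simp add: p)
qed

subsection \<open>Existence for the rescaled system\<close>

text \<open>The primitive of \<open>f\<close> vanishing at \<open>0\<close>; \<open>integral {0..s} f\<close> would be \<open>0\<close> for negative \<open>s\<close>.\<close>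

definition prim :: "real \<Rightarrow> (real \<Rightarrow> real) \<Rightarrow> real \<Rightarrow> real" where
  "prim S f s = integral {-S..s} f - integral {-S..0} f"

lemma prim_0 [simp]: "prim S f 0 = 0"
  by (simp add: prim_def)

lemma prim_has_derivative_within:
  assumes "continuous_on {-S..S} f" "s \<in> {-S..S}"
  shows "(prim S f has_real_derivative f s) (at s within {-S..S})"
  unfolding prim_def[abs_def] using integral_has_real_derivative[OF assms]
  by (auto intro!: derivative_eq_intros)

lemma prim_has_derivative:
  assumes "continuous_on {-S..S} f" "s \<in> {-S<..<S}"
  shows "(prim S f has_real_derivative f s) (at s)"
  using prim_has_derivative_within[OF assms(1), of s] at_within_Icc_at[of "-S" s S] assms(2) by auto

lemma continuous_on_prim:
  "continuous_on {-S..S} f \<Longrightarrow> continuous_on {-S..S} (prim S f)"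
  using DERIV_continuous[OF prim_has_derivative_within] by (simp add: continuous_on_eq_continuous_within)

text \<open>Mean value estimate for a difference of primitives that vanishes at 0. It yields both
  the size and the Lipschitz bounds of the integral operator below.\<close>

lemma prim_diff_le:
  assumes "continuous_on {-S..S} f" "continuous_on {-S..S} g"
    and "\<And>s. s \<in> {-S..S} \<Longrightarrow> \<bar>f s - g s\<bar> \<le> K" and s: "s \<in> {-S..S}"
  shows "\<bar>prim S f s - prim S g s\<bar> \<le> S * K"
proof -
  have "0 \<le> K" using assms(3)[OF s] by linarith
  have "norm ((\<lambda>s. prim S f s - prim S g s) s - (\<lambda>s. prim S f s - prim S g s) 0) \<le> K * norm (s - 0)"
    by (rule field_differentiable_bound[where S = "{-S..S}" and f' = "\<lambda>s. f s - g s"])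
      (use assms in \<open>auto intro!: derivative_intros prim_has_derivative_within\<close>)
  then have "\<bar>prim S f s - prim S g s\<bar> \<le> K * \<bar>s\<bar>" by simp
  also have "\<dots> \<le> K * S" using s \<open>0 \<le> K\<close> by (intro mult_left_mono) auto
  finally show ?thesis by (simp add: mult.commute)
qed

lemma prim_le:
  assumes "continuous_on {-S..S} f" "\<And>s. s \<in> {-S..S} \<Longrightarrow> \<bar>f s\<bar> \<le> K" "s \<in> {-S..S}"
  shows "\<bar>prim S f s\<bar> \<le> S * K"
proof -
  have "prim S (\<lambda>_. 0) s = 0" by (simp add: prim_def)
  then show ?thesis
    using prim_diff_le[of S f "\<lambda>_. 0" K s] assms by simp
qed

text \<open>Banach's theorem in a closed ball of the space of bounded continuous functions on the
  line. Composing with \<open>clamp a b\<close> extends the image of the operator from the interval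
  to the line by constants. The hypotheses speak of plain functions and of an arbitrary uniform
  bound \<open>d\<close>, so that users avoid the type of bounded continuous functions.\<close>

lemma contraction_on_interval_fixed_point:
  fixes \<Phi> :: "(real \<Rightarrow> real) \<Rightarrow> real \<Rightarrow> real"
  assumes "a \<le> b" "0 \<le> B"
    and cont: "\<And>w. continuous_on {a..b} w \<Longrightarrow> (\<And>s. s \<in> {a..b} \<Longrightarrow> \<bar>w s\<bar> \<le> B) \<Longrightarrow>
                continuous_on {a..b} (\<Phi> w)"
    and bound: "\<And>w s. continuous_on {a..b} w \<Longrightarrow> (\<And>s. s \<in> {a..b} \<Longrightarrow> \<bar>w s\<bar> \<le> B) \<Longrightarrow> s \<in> {a..b} \<Longrightarrow>
                \<bar>\<Phi> w s\<bar> \<le> B"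
    and contr: "\<And>w v d s. continuous_on {a..b} w \<Longrightarrow> (\<And>s. s \<in> {a..b} \<Longrightarrow> \<bar>w s\<bar> \<le> B) \<Longrightarrow>
                continuous_on {a..b} v \<Longrightarrow> (\<And>s. s \<in> {a..b} \<Longrightarrow> \<bar>v s\<bar> \<le> B) \<Longrightarrow>
                (\<And>s. s \<in> {a..b} \<Longrightarrow> \<bar>w s - v s\<bar> \<le> d) \<Longrightarrow> s \<in> {a..b} \<Longrightarrow>
                \<bar>\<Phi> w s - \<Phi> v s\<bar> \<le> d / 2"
  obtains w where "continuous_on {a..b} w" "\<And>s. s \<in> {a..b} \<Longrightarrow> \<bar>w s\<bar> \<le> B"
    "\<And>s. s \<in> {a..b} \<Longrightarrow> \<Phi> w s = w s"
proof -
  let ?S = "cball (0 :: real \<Rightarrow>\<^sub>C real) B"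
  let ?T = "\<lambda>w :: real \<Rightarrow>\<^sub>C real. Bcontfun (\<lambda>s. \<Phi> (apply_bcontfun w) (clamp a b s))"
  have clamp: "clamp a b s \<in> {a..b}" for s
    using clamp_in_interval[of a b s] \<open>a \<le> b\<close> by simp
  have le: "\<bar>apply_bcontfun w s\<bar> \<le> B" if "w \<in> ?S" for w s
    using dist_bounded[of 0 s w] that by (simp add: dist_real_def)
  have T: "apply_bcontfun (?T w) s = \<Phi> (apply_bcontfun w) (clamp a b s)" if "w \<in> ?S" for w s
  proof -
    have "continuous_on (cbox a b) (\<Phi> (apply_bcontfun w))"
      using cont[of w] le[OF that] by simp
    moreover have "\<bar>\<Phi> (apply_bcontfun w) (clamp a b s)\<bar> \<le> B" for s
      using bound[of w] le[OF that] clamp by simp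
    ultimately have "(\<lambda>s. \<Phi> (apply_bcontfun w) (clamp a b s)) \<in> bcontfun"
      by (auto simp: bcontfun_def bounded_iff intro!: clamp_continuous_on)
    then show ?thesis by (simp add: Bcontfun_inverse)
  qed
  have "\<exists>!w\<in>?S. ?T w = w"
  proof (rule Banach_fix[where c = "1 / 2"])
    show "complete ?S" by (simp add: complete_eq_closed)
    show "?S \<noteq> {}" using \<open>0 \<le> B\<close> by simp
    show "?T ` ?S \<subseteq> ?S"
    proof safe
      fix w assume w: "w \<in> ?S"
      have "dist 0 (?T w) \<le> B"
        by (rule dist_bound) (use T[OF w] bound[of w] le[OF w] clamp in \<open>simp add: dist_real_def\<close>)
      then show "?T w \<in> ?S" by simp
    qed
    fix w v assume w: "w \<in> ?S" and v: "v \<in> ?S"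
    have wv: "\<bar>apply_bcontfun w s - apply_bcontfun v s\<bar> \<le> dist w v" for s
      using dist_bounded[of w s v] by (simp add: dist_real_def)
    show "dist (?T w) (?T v) \<le> 1 / 2 * dist w v"
      by (rule dist_bound)
        (use T[OF w] T[OF v] contr[of w v "dist w v"] le[OF w] le[OF v] wv clamp in \<open>simp add: dist_real_def\<close>)
  qed auto
  then obtain w where w: "w \<in> ?S" "?T w = w" by blast
  show thesis
  proof (rule that)
    show "continuous_on {a..b} (apply_bcontfun w)" by simp
    show "\<bar>apply_bcontfun w s\<bar> \<le> B" for s using le[OF w(1)] .
    show "\<Phi> (apply_bcontfun w) s = apply_bcontfun w s" if "s \<in> {a..b}" for s
      using T[OF w(1), of s] w(2) that by simp
  qed
qed

text \<open>\<open>X\<close> and \<open>\<rho>\<close> are primitives of functions of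
  \<open>w\<close>, so the system is a single integral equation for \<open>w\<close>. Contraction
  comes from small \<open>\<epsilon>\<close> rather than from a short interval. The constant
  \<open>K\<close> serves both as a bound and as a Lipschitz constant of the bracket
  \<open>H\<close>, and \<open>8 * (K * \<epsilon>) \<le> 1\<close> makes the Lipschitz constant
  \<open>4 * (K * \<epsilon>)\<close> of the operator at most 1/2.\<close>

lemma rescaled_solution_exists:
  fixes k :: real
  assumes k: "0 \<le> k"
  defines "K \<equiv> 2 * k + 2 + 4 * cosh 4"
  assumes \<epsilon>: "0 \<le> \<epsilon>" "8 * (K * \<epsilon>) \<le> 1"
  obtains X \<rho> w :: "real \<Rightarrow> real" where
    "X 0 = 0" "\<rho> 0 = 0" "w 0 = 0"
    "\<And>s. s \<in> {-4<..<4} \<Longrightarrow> (X has_real_derivative 1 / cosh (w s)) (at s)"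
    "\<And>s. s \<in> {-4<..<4} \<Longrightarrow> (\<rho> has_real_derivative tanh (w s)) (at s)"
    "\<And>s. s \<in> {-4<..<4} \<Longrightarrow> (w has_real_derivative
        - (1 / 2) + \<epsilon> * (k / (1 + \<epsilon> * \<rho> s) - \<rho> s / 2 + X s / 2 * sinh (w s))) (at s)"
    "\<And>s. s \<in> {-4..4} \<Longrightarrow> 1 / 2 \<le> 1 + \<epsilon> * \<rho> s \<and> \<bar>w s\<bar> \<le> 4 \<and>
        \<bar>k / (1 + \<epsilon> * \<rho> s) - \<rho> s / 2 + X s / 2 * sinh (w s)\<bar> \<le> K"
proof -
  define X where "X w = prim 4 (\<lambda>s. 1 / cosh (w s))" for w
  define \<rho> where "\<rho> w = prim 4 (\<lambda>s. tanh (w s))" for w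
  define H where "H w s = k / (1 + \<epsilon> * \<rho> w s) - \<rho> w s / 2 + X w s / 2 * sinh (w s)" for w s
  \<comment> \<open>The term \<open>- (s / 2)\<close> is the exact solution for \<epsilon> = 0, the
    grim reaper.\<close>
  define \<Phi> where "\<Phi> w s = - (s / 2) + \<epsilon> * prim 4 (H w) s" for w s
  define ok where "ok w \<longleftrightarrow> continuous_on {-4..4::real} w \<and> (\<forall>s\<in>{-4..4}. \<bar>w s\<bar> \<le> 4)" for w :: "real \<Rightarrow> real"
  have K: "6 \<le> K" using k cosh_real_ge_1[of 4] by (simp add: K_def)
  have cs: "continuous_on {-4..4} (\<lambda>s. 1 / cosh (w s))" "continuous_on {-4..4} (\<lambda>s. tanh (w s))" if "ok w" for w
    using that unfolding ok_def by (auto intro!: continuous_intros)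
  have Xc: "continuous_on {-4..4} (X w)" and \<rho>c: "continuous_on {-4..4} (\<rho> w)" if "ok w" for w
    unfolding X_def \<rho>_def using cs[OF that] by (auto intro: continuous_on_prim)
  have Xb: "\<bar>X w s\<bar> \<le> 4" and \<rho>b: "\<bar>\<rho> w s\<bar> \<le> 4" if "ok w" "s \<in> {-4..4}" for w s
  proof -
    have "\<bar>tanh x\<bar> \<le> 1" "1 / cosh x \<le> 1" for x :: real
      using tanh_real_bounds[of x] cosh_real_ge_1[of x] by auto
    then show "\<bar>X w s\<bar> \<le> 4" "\<bar>\<rho> w s\<bar> \<le> 4"
      unfolding X_def \<rho>_def using prim_le[OF cs(1)[OF that(1)], of 1 s] prim_le[OF cs(2)[OF that(1)], of 1 s] that
      by simp_all
  qed
  have "6 * \<epsilon> \<le> K * \<epsilon>" using K \<epsilon> by (intro mult_right_mono) auto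
  then have \<epsilon>8: "\<epsilon> \<le> 1 / 8" using \<epsilon> by linarith
  \<comment> \<open>Up to the factor \<open>R\<close> this is the radius, which is thereby kept away
    from the singularity.\<close>
  have den: "1 / 2 \<le> 1 + \<epsilon> * \<rho> w s" if "ok w" "s \<in> {-4..4}" for w s
  proof -
    have "\<bar>\<epsilon> * \<rho> w s\<bar> \<le> 1 / 8 * 4"
      unfolding abs_mult using \<rho>b[OF that] \<epsilon> \<epsilon>8 by (intro mult_mono) auto
    then show ?thesis by linarith
  qed
  have Hc: "continuous_on {-4..4} (H w)" if "ok w" for w
    unfolding H_def[abs_def] using Xc[OF that] \<rho>c[OF that] that den[OF that]
    by (auto intro!: continuous_intros simp: ok_def) fastforce
  have sinh4: "\<bar>sinh (w s)\<bar> \<le> cosh 4" if "ok w" "s \<in> {-4..4}" for w s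
    using abs_sinh_le_cosh[of "w s"] cosh_le_cosh_abs[of "w s" 4] that by (force simp: ok_def)
  have Hb: "\<bar>H w s\<bar> \<le> K" if "ok w" "s \<in> {-4..4}" for w s
  proof -
    have 1: "\<bar>k / (1 + \<epsilon> * \<rho> w s)\<bar> \<le> k / (1 / 2)"
      unfolding abs_divide using den[OF that] k by (intro frac_le) auto
    have 2: "\<bar>X w s / 2 * sinh (w s)\<bar> \<le> 2 * cosh 4"
      unfolding abs_mult using Xb[OF that] sinh4[OF that] by (intro mult_mono) auto
    have "\<bar>H w s\<bar> \<le> k / (1 / 2) + 2 + 2 * cosh 4"
      unfolding H_def using \<rho>b[OF that] by (intro abs_add3_le 1 2) simp
    then show ?thesis
      using cosh_real_ge_1[of 4] by (simp add: K_def)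
  qed
  have HL: "\<bar>H w s - H v s\<bar> \<le> K * d"
    if w: "ok w" and v: "ok v" and d: "\<And>s. s \<in> {-4..4} \<Longrightarrow> \<bar>w s - v s\<bar> \<le> d" and s: "s \<in> {-4..4}" for w v d s
  proof -
    have d0: "0 \<le> d" using d[OF s] by linarith
    have dX: "\<bar>X w s - X v s\<bar> \<le> 4 * d"
      unfolding X_def by (intro prim_diff_le cs w v s order_trans[OF abs_sech_diff_le] d)
    have d\<rho>: "\<bar>\<rho> w s - \<rho> v s\<bar> \<le> 4 * d"
      unfolding \<rho>_def by (intro prim_diff_le cs w v s order_trans[OF abs_tanh_diff_le] d)
    let ?p = "1 + \<epsilon> * \<rho> w s" and ?q = "1 + \<epsilon> * \<rho> v s"
    have pq: "1 / 2 \<le> ?p" "1 / 2 \<le> ?q" using den w v s by auto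
    have eq: "k / ?p - k / ?q = k * (\<epsilon> * (\<rho> v s - \<rho> w s)) / (?p * ?q)"
      using pq by (simp add: field_simps)
    have "\<bar>k * (\<epsilon> * (\<rho> v s - \<rho> w s))\<bar> \<le> k * (1 / 8 * (4 * d))"
      unfolding abs_mult using k \<epsilon> \<epsilon>8 d\<rho> d0 by (intro mult_mono) (auto simp: abs_minus_commute)
    moreover have "1 / 2 * (1 / 2) \<le> ?p * ?q" using pq by (intro mult_mono) auto
    ultimately have "\<bar>k / ?p - k / ?q\<bar> \<le> k * (1 / 8 * (4 * d)) / (1 / 2 * (1 / 2))"
      unfolding eq abs_divide using pq by (intro frac_le) auto
    then have 1: "\<bar>k / ?p - k / ?q\<bar> \<le> 2 * k * d" by (simp add: mult_ac)
    have 2: "\<bar>(X w s - X v s) / 2 * sinh (w s)\<bar> \<le> 2 * d * cosh 4"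
      unfolding abs_mult using dX sinh4[OF w s] d0 by (intro mult_mono) auto
    have 3: "\<bar>X v s / 2 * (sinh (w s) - sinh (v s))\<bar> \<le> 2 * (cosh 4 * d)"
      unfolding abs_mult
    proof (intro mult_mono)
      show "\<bar>X v s / 2\<bar> \<le> 2" using Xb[OF v s] by simp
      have "\<bar>sinh (w s) - sinh (v s)\<bar> \<le> cosh 4 * \<bar>w s - v s\<bar>"
        using w v s by (intro abs_sinh_diff_le) (auto simp: ok_def)
      also have "\<dots> \<le> cosh 4 * d" using d[OF s] by (intro mult_left_mono) auto
      finally show "\<bar>sinh (w s) - sinh (v s)\<bar> \<le> cosh 4 * d" .
    qed (use d0 in auto)
    have eqH: "H w s - H v s = (k / ?p - k / ?q) + - ((\<rho> w s - \<rho> v s) / 2)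
        + (X w s - X v s) / 2 * sinh (w s) + X v s / 2 * (sinh (w s) - sinh (v s))"
      unfolding H_def by (simp add: algebra_simps diff_divide_distrib)
    have "\<bar>H w s - H v s\<bar> \<le> 2 * k * d + 2 * d + 2 * d * cosh 4 + 2 * (cosh 4 * d)"
      unfolding eqH by (intro abs_add4_le 1 2 3) (use d\<rho> in simp)
    then show ?thesis unfolding K_def by (simp add: algebra_simps)
  qed
  obtain w where w: "continuous_on {-4..4} w" "\<And>s. s \<in> {-4..4} \<Longrightarrow> \<bar>w s\<bar> \<le> 4"
    "\<And>s. s \<in> {-4..4} \<Longrightarrow> \<Phi> w s = w s"
  proof (rule contraction_on_interval_fixed_point[of "-4" 4 4 \<Phi>])
    fix w :: "real \<Rightarrow> real"
    assume "continuous_on {-4..4} w" and "\<And>s. s \<in> {-4..4} \<Longrightarrow> \<bar>w s\<bar> \<le> 4"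
    then have w: "ok w" by (auto simp: ok_def)
    show "continuous_on {-4..4} (\<Phi> w)"
      unfolding \<Phi>_def[abs_def] by (intro continuous_intros continuous_on_prim Hc w) simp
    show "\<bar>\<Phi> w s\<bar> \<le> 4" if s: "s \<in> {-4..4}" for s
    proof -
      \<comment> \<open>The main part is at most 2 in absolute value and the correction at most 1/2,
        so the ball of radius 4 is preserved.\<close>
      have "\<bar>\<epsilon> * prim 4 (H w) s\<bar> \<le> \<epsilon> * (4 * K)"
        unfolding abs_mult using prim_le[OF Hc[OF w] Hb[OF w] s] \<epsilon> by (intro mult_mono) auto
      then show ?thesis using \<epsilon>(2) s unfolding \<Phi>_def by (auto simp: algebra_simps abs_le_iff)
    qed
    fix v :: "real \<Rightarrow> real" and d s :: real
    assume "continuous_on {-4..4} v" and "\<And>s. s \<in> {-4..4} \<Longrightarrow> \<bar>v s\<bar> \<le> 4"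
      and d: "\<And>s. s \<in> {-4..4} \<Longrightarrow> \<bar>w s - v s\<bar> \<le> d" and s: "s \<in> {-4..4}"
    then have v: "ok v" by (auto simp: ok_def)
    have d0: "0 \<le> d" using d[OF s] by linarith
    have "\<bar>\<Phi> w s - \<Phi> v s\<bar> = \<epsilon> * \<bar>prim 4 (H w) s - prim 4 (H v) s\<bar>"
      using \<epsilon> unfolding \<Phi>_def by (simp add: abs_mult flip: right_diff_distrib)
    also have "\<dots> \<le> \<epsilon> * (4 * (K * d))"
      using \<epsilon> by (intro mult_left_mono prim_diff_le Hc w v s HL d) auto
    also have "\<dots> \<le> d / 2" using mult_right_mono[OF \<epsilon>(2) d0] by (simp add: algebra_simps)
    finally show "\<bar>\<Phi> w s - \<Phi> v s\<bar> \<le> d / 2" .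
  qed auto
  then have ok: "ok w" by (simp add: ok_def)
  show thesis
  proof (rule that[of "X w" "\<rho> w" w])
    show "X w 0 = 0" "\<rho> w 0 = 0" by (simp_all add: X_def \<rho>_def)
    show "w 0 = 0" using w(3)[of 0] by (simp add: \<Phi>_def)
    fix s :: real
    show "(X w has_real_derivative 1 / cosh (w s)) (at s)" if "s \<in> {-4<..<4}"
      unfolding X_def using prim_has_derivative[OF cs(1)[OF ok] that] .
    show "(\<rho> w has_real_derivative tanh (w s)) (at s)" if "s \<in> {-4<..<4}"
      unfolding \<rho>_def using prim_has_derivative[OF cs(2)[OF ok] that] .
    show "(w has_real_derivative
        - (1 / 2) + \<epsilon> * (k / (1 + \<epsilon> * \<rho> w s) - \<rho> w s / 2 + X w s / 2 * sinh (w s))) (at s)"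
      if s: "s \<in> {-4<..<4}"
    \<comment> \<open>\<open>w\<close> and \<open>\<Phi> w\<close> agree only on the interval, so
      the derivative is transferred on its interior.\<close>
    proof (rule has_field_derivative_transform_within_open[of "\<Phi> w" _ _ "{-4<..<4}"])
      show "(\<Phi> w has_real_derivative
          - (1 / 2) + \<epsilon> * (k / (1 + \<epsilon> * \<rho> w s) - \<rho> w s / 2 + X w s / 2 * sinh (w s))) (at s)"
        unfolding \<Phi>_def[abs_def] using prim_has_derivative[OF Hc[OF ok] s]
        by (auto intro!: derivative_eq_intros simp: H_def)
    qed (use s w(3) in auto)
    show "1 / 2 \<le> 1 + \<epsilon> * \<rho> w s \<and> \<bar>w s\<bar> \<le> 4 \<and>
        \<bar>k / (1 + \<epsilon> * \<rho> w s) - \<rho> w s / 2 + X w s / 2 * sinh (w s)\<bar> \<le> K" if "s \<in> {-4..4}"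
      using den[OF ok that] Hb[OF ok that] w(2)[OF that] by (simp add: H_def)
  qed
qed

subsection \<open>The branch at radius \<open>R - 1 / R\<close>\<close>

lemma sqrt_1_plus_sinh_square: "sqrt (1 + (sinh x)\<^sup>2) = cosh x" for x :: real
  by (rule real_sqrt_unique) (simp_all add: cosh_square_eq)

text \<open>\<open>arctan (sinh x)\<close> is the Gudermannian function. Its derivative
  \<open>1 / cosh x\<close> is the cosine of its value, so in the variable \<open>w\<close> the
  leading term \<open>- (r / 2) * cos \<theta>\<close> loses its cosine and becomes constant at
  leading order.\<close>

lemma cos_arctan_sinh: "cos (arctan (sinh x)) = 1 / cosh x" for x :: real
  by (simp add: cos_arctan sqrt_1_plus_sinh_square)

lemma sin_arctan_sinh: "sin (arctan (sinh x)) = tanh x" for x :: real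
  by (simp add: sin_arctan sqrt_1_plus_sinh_square tanh_def)

lemma profile_solution_of_rescaled:
  fixes X \<rho> w :: "real \<Rightarrow> real"
  assumes "0 < R" and \<epsilon>: "\<epsilon> = 1 / R\<^sup>2" and init: "X 0 = 0" "\<rho> 0 = 0" "w 0 = 0"
    and dX: "\<And>s. s \<in> {-4<..<4} \<Longrightarrow> (X has_real_derivative 1 / cosh (w s)) (at s)"
    and d\<rho>: "\<And>s. s \<in> {-4<..<4} \<Longrightarrow> (\<rho> has_real_derivative tanh (w s)) (at s)"
    and dw: "\<And>s. s \<in> {-4<..<4} \<Longrightarrow> (w has_real_derivative
        - (1 / 2) + \<epsilon> * ((real n - 1) / (1 + \<epsilon> * \<rho> s) - \<rho> s / 2 + X s / 2 * sinh (w s))) (at s)"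
    and pos: "\<And>s. s \<in> {-4<..<4} \<Longrightarrow> 0 < 1 + \<epsilon> * \<rho> s"
  shows "profile_solution n R {-4 / R<..<4 / R} (\<lambda>t. X (R * t) / R) (\<lambda>t. R + \<rho> (R * t) / R)
    (\<lambda>t. arctan (sinh (w (R * t))))"
  unfolding profile_solution_def
proof (intro conjI ballI)
  fix t assume "t \<in> {-4 / R<..<4 / R}"
  then have s: "R * t \<in> {-4<..<4}" using \<open>0 < R\<close> by (auto simp: field_simps)
  let ?s = "R * t"
  let ?p = "1 + \<epsilon> * \<rho> ?s"
  have r: "R + \<rho> ?s / R = R * ?p" using \<open>0 < R\<close> by (simp add: \<epsilon> field_simps power2_eq_square)
  show "0 < R + \<rho> ?s / R" unfolding r using \<open>0 < R\<close> pos[OF s] by simp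
  have lin: "((\<lambda>t. R * t) has_real_derivative R) (at t)"
    by (auto intro!: derivative_eq_intros)
  show "((\<lambda>t. X (R * t) / R) has_real_derivative cos (arctan (sinh (w ?s)))) (at t)"
    using DERIV_chain2[OF dX[OF s] lin, THEN DERIV_cdivide, of R] \<open>0 < R\<close> by (simp add: cos_arctan_sinh)
  show "((\<lambda>t. R + \<rho> (R * t) / R) has_real_derivative sin (arctan (sinh (w ?s)))) (at t)"
    using DERIV_add[OF DERIV_const DERIV_chain2[OF d\<rho>[OF s] lin, THEN DERIV_cdivide, of R], of R] \<open>0 < R\<close>
    by (simp add: sin_arctan_sinh)
  define w' where "w' = - (1 / 2) + \<epsilon> * ((real n - 1) / ?p - \<rho> ?s / 2 + X ?s / 2 * sinh (w ?s))"
  define c where "c = cosh (w ?s)"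
  have c: "0 < c" "1 + (sinh (w ?s))\<^sup>2 = c\<^sup>2"
    using cosh_square_eq[of "w ?s"] by (simp_all add: c_def)
  have "((\<lambda>t. arctan (sinh (w (R * t)))) has_real_derivative inverse (1 + (sinh (w ?s))\<^sup>2) * (c * (w' * R))) (at t)"
    unfolding c_def
    by (rule DERIV_chain2[OF DERIV_arctan] DERIV_chain2[OF has_field_derivative_sinh[OF DERIV_ident, simplified]]
        DERIV_chain2[OF dw[OF s] lin, folded w'_def])+
  also have "inverse (1 + (sinh (w ?s))\<^sup>2) * (c * (w' * R)) = R * w' / c"
    unfolding c(2) using c(1) by (simp add: field_simps power2_eq_square)
  \<comment> \<open>Since R \<epsilon> = 1 / R, the terms -R/2 and -R \<epsilon> \<rho>/2 combine to
    -r/2, and X R \<epsilon> becomes the unscaled x.\<close>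
  also have "R * w' / c = ((real n - 1) / (R * ?p) - R * ?p / 2) * (1 / c) + X ?s / R / 2 * tanh (w ?s)"
  proof -
    have R\<epsilon>: "R * \<epsilon> = 1 / R" using \<open>0 < R\<close> by (simp add: \<epsilon> power2_eq_square)
    have "R * w' = - (R / 2) + (R * \<epsilon>) * ((real n - 1) / ?p) - R * \<epsilon> * \<rho> ?s / 2 + (R * \<epsilon>) * X ?s / 2 * sinh (w ?s)"
      unfolding w'_def by (simp add: algebra_simps)
    also have "(R * \<epsilon>) * ((real n - 1) / ?p) = (real n - 1) / (R * ?p)"
      unfolding R\<epsilon> by simp
    also have "- (R / 2) + (real n - 1) / (R * ?p) - R * \<epsilon> * \<rho> ?s / 2 + (R * \<epsilon>) * X ?s / 2 * sinh (w ?s)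
        = (real n - 1) / (R * ?p) - R * ?p / 2 + X ?s / R / 2 * sinh (w ?s)"
    proof -
      have Rp: "R * ?p / 2 = R / 2 + R * \<epsilon> * \<rho> ?s / 2" by (simp add: distrib_left add_divide_distrib)
      show ?thesis unfolding Rp R\<epsilon> by simp
    qed
    finally have "R * w' = (real n - 1) / (R * ?p) - R * ?p / 2 + X ?s / R / 2 * sinh (w ?s)" .
    moreover have "tanh (w ?s) = sinh (w ?s) / c" by (simp add: c_def tanh_def)
    ultimately show ?thesis by (simp add: add_divide_distrib diff_divide_distrib left_diff_distrib)
  qed
  finally show "((\<lambda>t. arctan (sinh (w (R * t)))) has_real_derivative
      ((real n - 1) / (R + \<rho> ?s / R) - (R + \<rho> ?s / R) / 2) * cos (arctan (sinh (w ?s)))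
      + X ?s / R / 2 * sin (arctan (sinh (w ?s)))) (at t)"
    unfolding r cos_arctan_sinh sin_arctan_sinh c_def .
qed (use init \<open>0 < R\<close> in \<open>auto simp: is_interval_1\<close>)

text \<open>Membership of the later time already gives monotonicity on an interval containing the
  earlier one. This makes the inverse in \<open>branch_time\<close> meaningful.\<close>

lemma inj_on_branch: "inj_on (profile_r n R) (branch n R)"
proof (rule linorder_inj_onI')
  fix t u assume "t \<in> branch n R" "u \<in> branch n R" "t < u"
  then have "profile_r n R u < profile_r n R t"
    unfolding branch_def by (auto dest!: monotone_onD[of _ _ _ _ t u])
  then show "profile_r n R t \<noteq> profile_r n R u" by simp
qed

text \<open>At rescaled time 3 the grim reaper lies below -3/2, which leaves room 1/2 for the
  perturbation before the level -1. The bound follows from cosh x >= exp x / 2, which gives at least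
  3 - 2 ln 2.\<close>

lemma ln_cosh_3_halves: "3 / 2 < 2 * ln (cosh (3 / 2 :: real))"
proof -
  have "ln (exp (3 / 2) / 2) \<le> ln (cosh (3 / 2 :: real))"
    by (subst ln_le_cancel_iff) (auto simp: cosh_field_def intro: add_pos_pos)
  moreover have "ln (exp (3 / 2) / 2 :: real) = 3 / 2 - ln 2"
    by (simp add: ln_div)
  ultimately show ?thesis using ln2_le_25_over_36 by linarith
qed

text \<open>All estimates at a fixed radius. The condition \<open>32 * K \<le> R\<^sup>2\<close>
  makes the height error \<open>16 * (K * \<epsilon>)\<close> at most 1/2, so the level \<rho> = -1
  is reached at a rescaled time between 1 and 3. In the last claim \<open>s\<close> is this time and
  \<open>y\<close> the value of \<open>w\<close> there.\<close>

lemma branch_at_R_minus_inverse: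
  fixes n :: nat and R :: real
  assumes n: "1 \<le> n"
  defines "K \<equiv> 2 * (real n - 1) + 2 + 4 * cosh 4"
  assumes R: "0 < R" "32 * K \<le> R\<^sup>2"
  shows "R - 1 / R \<in> branch_radii n R" (is ?th1)
    and "1 / cosh 4 / R \<le> branch_graph n R (R - 1 / R)" (is ?th2)
    and "branch_graph n R (R - 1 / R) \<le> 4 / R" (is ?th3)
    and "\<exists>s y. 0 \<le> s \<and> \<bar>2 * ln (cosh (s / 2)) - 1\<bar> \<le> 16 * K / R\<^sup>2 \<and> \<bar>y + s / 2\<bar> \<le> 4 * K / R\<^sup>2 \<and>
      branch_theta n R (R - 1 / R) = arctan (sinh y)" (is ?th4)
proof -
  define \<epsilon> where "\<epsilon> = 1 / R\<^sup>2"
  have k: "0 \<le> real n - 1" using n by simp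
  then have "0 \<le> K" unfolding K_def by (intro add_nonneg_nonneg mult_nonneg_nonneg) auto
  then have \<epsilon>: "0 \<le> \<epsilon>" "32 * (K * \<epsilon>) \<le> 1" "0 \<le> K * \<epsilon>" using R by (auto simp: \<epsilon>_def field_simps)
  then have \<epsilon>8: "8 * (K * \<epsilon>) \<le> 1" by linarith
  obtain X \<rho> w :: "real \<Rightarrow> real" where init: "X 0 = 0" "\<rho> 0 = 0" "w 0 = 0"
    and dX: "\<And>s. s \<in> {-4<..<4} \<Longrightarrow> (X has_real_derivative 1 / cosh (w s)) (at s)"
    and d\<rho>: "\<And>s. s \<in> {-4<..<4} \<Longrightarrow> (\<rho> has_real_derivative tanh (w s)) (at s)"
    and dw: "\<And>s. s \<in> {-4<..<4} \<Longrightarrow> (w has_real_derivative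
        - (1 / 2) + \<epsilon> * ((real n - 1) / (1 + \<epsilon> * \<rho> s) - \<rho> s / 2 + X s / 2 * sinh (w s))) (at s)"
    and bnd: "\<And>s. s \<in> {-4..4} \<Longrightarrow> 1 / 2 \<le> 1 + \<epsilon> * \<rho> s \<and> \<bar>w s\<bar> \<le> 4 \<and>
        \<bar>(real n - 1) / (1 + \<epsilon> * \<rho> s) - \<rho> s / 2 + X s / 2 * sinh (w s)\<bar> \<le> K"
    using rescaled_solution_exists[OF k \<epsilon>(1) \<epsilon>8[unfolded K_def], folded K_def] by metis
  define H where "H s = (real n - 1) / (1 + \<epsilon> * \<rho> s) - \<rho> s / 2 + X s / 2 * sinh (w s)" for s
  note dw = dw[folded H_def]
  have \<epsilon>H: "\<bar>\<epsilon> * H s\<bar> \<le> K * \<epsilon>" if "s \<in> {-4..4}" for s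
    using bnd[OF that] mult_left_mono[OF _ \<epsilon>(1), of "\<bar>H s\<bar>" K] \<epsilon>(1) by (simp add: H_def abs_mult mult.commute)
  have pos: "0 < 1 + \<epsilon> * \<rho> s" if "s \<in> {-4<..<4}" for s
    using bnd[of s] that by auto
  note sol = profile_solution_of_rescaled[OF R(1) \<epsilon>_def init dX d\<rho> dw[unfolded H_def] pos]
  have flow: "profile_x n R t = X (R * t) / R" "profile_r n R t = R + \<rho> (R * t) / R"
    "profile_theta n R t = arctan (sinh (w (R * t)))" if "0 \<le> t" "R * t < 4" for t
  proof -
    have "t \<in> {-4 / R<..<4 / R}" using that R by (auto simp: field_simps intro: less_le_trans[of _ 0])
    from profile_flow_eq[OF n sol that(1) this]
    show "profile_x n R t = X (R * t) / R" "profile_r n R t = R + \<rho> (R * t) / R"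
      "profile_theta n R t = arctan (sinh (w (R * t)))"
      by (simp_all add: profile_x_def profile_r_def profile_theta_def)
  qed
  \<comment> \<open>The slope of \<open>w\<close> is at most -1/2 + 1/32. Negative \<open>w\<close>
    means a negative angle, hence a strictly decreasing radius.\<close>
  have w_neg: "w s < 0" if "0 < s" "s < 4" for s
  proof -
    have "w s < w 0"
    proof (rule DERIV_neg_imp_decreasing[OF that(1)])
      fix u assume u: "0 \<le> u" "u \<le> s"
      have "- (1 / 2) + \<epsilon> * H u < 0" using \<epsilon>H[of u] \<epsilon>(2) u that by auto
      then show "\<exists>y. (w has_real_derivative y) (at u) \<and> y < 0" using dw[of u] u that by auto
    qed
    then show ?thesis by (simp add: init)
  qed
  have \<rho>_cont: "continuous_on {a..b} \<rho>" if "0 \<le> a" "b < 4" for a b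
    using that by (intro continuous_at_imp_continuous_on ballI DERIV_isCont[OF d\<rho>]) auto
  have \<rho>_less: "\<rho> b < \<rho> a" if "0 \<le> a" "a < b" "b < 4" for a b
  proof (rule DERIV_neg_imp_decreasing_open[OF that(2)])
    fix u assume u: "a < u" "u < b"
    have "tanh (w u) < 0" using w_neg[of u] u that by simp
    then show "\<exists>y. (\<rho> has_real_derivative y) (at u) \<and> y < 0" using d\<rho>[of u] u that by auto
  qed (use \<rho>_cont that in auto)
  have X_ge: "s / cosh 4 \<le> X s" if "0 \<le> s" "s < 4" for s
  proof -
    have "X 0 - 0 / cosh 4 \<le> X s - s / cosh 4"
    proof (rule DERIV_nonneg_imp_nondecreasing[OF that(1)])
      fix u assume u: "0 \<le> u" "u \<le> s"
      have "cosh (w u) \<le> cosh 4" using bnd[of u] u that by (intro cosh_le_cosh_abs) auto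
      then have "0 \<le> 1 / cosh (w u) - 1 / cosh 4" by (simp add: frac_le)
      moreover have "((\<lambda>s. X s - s / cosh 4) has_real_derivative 1 / cosh (w u) - 1 / cosh 4) (at u)"
        using u that by (auto intro!: derivative_eq_intros dX)
      ultimately show "\<exists>y. ((\<lambda>s. X s - s / cosh 4) has_real_derivative y) (at u) \<and> 0 \<le> y" by blast
    qed
    then show ?thesis by (simp add: init)
  qed
  have w_err: "\<bar>w s + s / 2\<bar> \<le> 4 * (K * \<epsilon>)" if "0 \<le> s" "s < 4" for s
  proof -
    have "\<bar>(w s + s / 2) - (w 0 + 0 / 2)\<bar> \<le> (K * \<epsilon>) * s"
      by (rule abs_increment_le[where f = "\<lambda>s. w s + s / 2" and f' = "\<lambda>s. \<epsilon> * H s"])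
        (use that in \<open>auto intro!: derivative_eq_intros dw \<epsilon>H\<close>)
    also have "\<dots> \<le> K * \<epsilon> * 4" using that \<epsilon>H[of 0] by (intro mult_left_mono) auto
    finally show ?thesis by (simp add: init)
  qed
  \<comment> \<open>The grim reaper height \<open>- 2 * ln (cosh (s / 2))\<close> is the primitive
    of \<open>tanh (- (s / 2))\<close>. As \<open>tanh\<close> is 1-Lipschitz, the error of
    \<open>w\<close> passes to the slope of \<open>\<rho>\<close>, and integration over time at most
    4 gives another factor 4.\<close>
  have \<rho>_err: "\<bar>\<rho> s + 2 * ln (cosh (s / 2))\<bar> \<le> 16 * (K * \<epsilon>)" if "0 \<le> s" "s < 4" for s
  proof -
    have "\<bar>(\<rho> s + 2 * ln (cosh (s / 2))) - (\<rho> 0 + 2 * ln (cosh (0 / 2)))\<bar> \<le> (4 * (K * \<epsilon>)) * s"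
    proof (rule abs_increment_le[where f = "\<lambda>s. \<rho> s + 2 * ln (cosh (s / 2))" and f' = "\<lambda>s. tanh (w s) - tanh (- (s / 2))"])
      show "((\<lambda>s. \<rho> s + 2 * ln (cosh (s / 2))) has_real_derivative tanh (w u) - tanh (- (u / 2))) (at u)"
        if "u \<in> {0..s}" for u
        using that \<open>s < 4\<close> by (auto intro!: derivative_eq_intros d\<rho> simp: tanh_def)
      show "\<bar>tanh (w u) - tanh (- (u / 2))\<bar> \<le> 4 * (K * \<epsilon>)" if "u \<in> {0..s}" for u
        using abs_tanh_diff_le[of "w u" "- (u / 2)"] w_err[of u] that \<open>s < 4\<close> by simp
    qed (use that in auto)
    also have "\<dots> \<le> (4 * (K * \<epsilon>)) * 4" using that \<epsilon>H[of 0] by (intro mult_left_mono) auto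
    finally show ?thesis by (simp add: init)
  qed
  have "\<rho> 3 \<le> -1" using \<rho>_err[of 3] ln_cosh_3_halves \<epsilon>(2) by simp
  then obtain s where s: "0 \<le> s" "s \<le> 3" "\<rho> s = -1"
    using IVT2'[of \<rho> 3 "-1" 0] \<rho>_cont[of 0 3] init by auto
  \<comment> \<open>The slope of \<open>\<rho>\<close> is at most 1 in absolute value, so a drop by
    1 takes time at least 1. This gives the lower bound for \<open>X\<close> independently of
    \<open>R\<close>.\<close>
  have "\<bar>\<rho> s - \<rho> 0\<bar> \<le> 1 * s"
  proof (rule abs_increment_le[where f' = "\<lambda>s. tanh (w s)"])
    show "\<bar>tanh (w u)\<bar> \<le> 1" for u using tanh_real_bounds[of "w u"] by auto
  qed (use s d\<rho> in auto)
  then have s1: "1 \<le> s" using s init by simp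
  define t where "t = s / R"
  have Rt: "R * t = s" and t: "0 < t" using R s1 by (auto simp: t_def)
  have le: "R * u \<le> R * t" if "u \<le> t" for u using that R by simp
  have "t \<in> branch n R"
    unfolding branch_def
  proof (intro CollectI conjI ballI monotone_onI)
    show "t \<in> profile_ivl n R"
      unfolding profile_ivl_def using sol R s s1 by (auto simp: t_def field_simps intro!: exI)
    show "0 < profile_x n R u" if "u \<in> {0<..t}" for u
    proof -
      have u: "0 < R * u" "R * u < 4" using that R le[of u] Rt s by auto
      then have "0 < R * u / cosh 4" by simp
      then have "0 < X (R * u)" using X_ge[of "R * u"] u by linarith
      then show ?thesis using flow(1)[of u] that u R by simp
    qed
    show "profile_r n R v < profile_r n R u" if "u \<in> {0..t}" "v \<in> {0..t}" "u < v" for u v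
    proof -
      have "0 \<le> R * u" "R * u < R * v" "R * v < 4" "R * u < 4"
        using that R le[of v] le[of u] Rt s by auto
      then show ?thesis using flow(2)[of u] flow(2)[of v] \<rho>_less[of "R * u" "R * v"] that R
        by (simp add: divide_strict_right_mono)
    qed
  qed (use t in auto)
  moreover have r: "profile_r n R t = R - 1 / R" using flow(2)[of t] t s by (simp add: Rt)
  ultimately show ?th1 unfolding branch_radii_def by force
  have time: "branch_time n R (R - 1 / R) = t"
    unfolding branch_time_def r[symmetric] by (rule the_inv_into_f_f[OF inj_on_branch]) fact
  have graph: "branch_graph n R (R - 1 / R) = X s / R"
    unfolding branch_graph_def time using flow(1)[of t] t s by (simp add: Rt)
  have "1 / cosh 4 \<le> s / cosh 4" using s1 by (simp add: divide_right_mono)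
  then have "1 / cosh 4 \<le> X s" using X_ge[of s] s by linarith
  then show ?th2 unfolding graph using R by (intro divide_right_mono) auto
  have "\<bar>X s - X 0\<bar> \<le> 1 * s"
    by (rule abs_increment_le[where f' = "\<lambda>s. 1 / cosh (w s)"]) (use s dX cosh_real_ge_1 in auto)
  then have "X s \<le> 4" using s init by simp
  then show ?th3 unfolding graph using R by (intro divide_right_mono) auto
  have "branch_theta n R (R - 1 / R) = arctan (sinh (w s))"
    unfolding branch_theta_def time using flow(3)[of t] t s by (simp add: Rt)
  moreover have "\<bar>2 * ln (cosh (s / 2)) - 1\<bar> \<le> 16 * K / R\<^sup>2" "\<bar>w s + s / 2\<bar> \<le> 4 * K / R\<^sup>2"
    using \<rho>_err[of s] w_err[of s] s by (simp_all add: \<epsilon>_def)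
  ultimately show ?th4 using s(1) by blast
qed

section \<open>Passage to the limit as R tends to infinity\<close>

theorem lemma5:
  fixes n :: nat
  assumes "2 \<le> n"
  shows "(\<forall>\<^sub>F R in at_top. R - 1 / R \<in> branch_radii n R) \<and>
    (\<exists>\<theta>\<^sub>1<0. ((\<lambda>R. branch_theta n R (R - 1 / R)) \<longlongrightarrow> \<theta>\<^sub>1) at_top) \<and>
    (\<exists>C\<^sub>1>0. \<exists>C\<^sub>2>0. \<forall>\<^sub>F R in at_top.
       C\<^sub>1 / R \<le> branch_graph n R (R - 1 / R) \<and> branch_graph n R (R - 1 / R) \<le> C\<^sub>2 / R)"
proof -
  define K where "K = 2 * (real n - 1) + 2 + 4 * cosh 4"
  have n: "1 \<le> n" using assms by simp
  have square: "filterlim (\<lambda>R :: real. R\<^sup>2) at_top at_top"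
    by (rule filterlim_pow_at_top) (auto simp: filterlim_ident)
  have large: "\<forall>\<^sub>F R in at_top. 0 < R \<and> 32 * K \<le> R\<^sup>2"
  proof (rule eventually_conj)
    show "\<forall>\<^sub>F R in at_top. 32 * K \<le> R\<^sup>2" using square by (simp add: filterlim_at_top)
  qed (rule eventually_gt_at_top)
  note at = branch_at_R_minus_inverse[OF n, folded K_def]
  \<comment> \<open>Choosing a pair of witnesses for each radius gives functions of \<open>R\<close>
    whose limits can be taken.\<close>
  have "\<forall>R. \<exists>p. 0 < R \<and> 32 * K \<le> R\<^sup>2 \<longrightarrow>
      0 \<le> fst p \<and> \<bar>2 * ln (cosh (fst p / 2)) - 1\<bar> \<le> 16 * K / R\<^sup>2 \<and> \<bar>snd p + fst p / 2\<bar> \<le> 4 * K / R\<^sup>2 \<and>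
      branch_theta n R (R - 1 / R) = arctan (sinh (snd p))"
    using at(4) by fastforce
  then obtain p where p: "\<And>R. 0 < R \<and> 32 * K \<le> R\<^sup>2 \<Longrightarrow>
      0 \<le> fst (p R) \<and> \<bar>2 * ln (cosh (fst (p R) / 2)) - 1\<bar> \<le> 16 * K / R\<^sup>2 \<and>
      \<bar>snd (p R) + fst (p R) / 2\<bar> \<le> 4 * K / R\<^sup>2 \<and>
      branch_theta n R (R - 1 / R) = arctan (sinh (snd (p R)))"
    by metis
  \<comment> \<open>Here \<open>s R\<close> is half the rescaled time at which the level is
    reached.\<close>
  define s y where "s R = fst (p R) / 2" and "y R = snd (p R)" for R
  have ev: "\<forall>\<^sub>F R in at_top. 0 \<le> s R" "\<forall>\<^sub>F R in at_top. \<bar>2 * ln (cosh (s R)) - 1\<bar> \<le> 16 * K / R\<^sup>2"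
    "\<forall>\<^sub>F R in at_top. \<bar>y R + s R\<bar> \<le> 4 * K / R\<^sup>2"
    "\<forall>\<^sub>F R in at_top. arctan (sinh (y R)) = branch_theta n R (R - 1 / R)"
    using p by (auto intro!: eventually_mono[OF large] simp: s_def y_def)
  have "((\<lambda>R. 16 * K / R\<^sup>2) \<longlongrightarrow> 0) at_top" "((\<lambda>R. 4 * K / R\<^sup>2) \<longlongrightarrow> 0) at_top"
    by (intro tendsto_divide_0[OF tendsto_const] filterlim_at_top_imp_at_infinity square)+
  then have ln: "((\<lambda>R. 2 * ln (cosh (s R)) - 1) \<longlongrightarrow> 0) at_top" and ys: "((\<lambda>R. y R + s R) \<longlongrightarrow> 0) at_top"
    using ev(2,3) by (auto intro: Lim_null_comparison)
  \<comment> \<open>\<open>S\<close> is the positive solution of 2 ln (cosh S) = 1, half the time at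
    which the grim reaper reaches height -1.\<close>
  define S where "S = arcosh (exp (1 / 2) :: real)"
  \<comment> \<open>The exponential undoes the logarithm and leaves \<open>cosh (s R)\<close>. Since
    \<open>exp (1 / 2)\<close> exceeds 1, \<open>arcosh\<close> is continuous there, and
    \<open>0 \<le> s R\<close> selects the right preimage.\<close>
  have "((\<lambda>R. exp ((2 * ln (cosh (s R)) - 1) / 2 + 1 / 2)) \<longlongrightarrow> exp (0 / 2 + 1 / 2)) at_top"
    by (intro tendsto_intros ln) simp
  then have "((\<lambda>R. cosh (s R)) \<longlongrightarrow> exp (1 / 2)) at_top"
    by (simp add: diff_divide_distrib)
  then have "((\<lambda>R. arcosh (cosh (s R))) \<longlongrightarrow> S) at_top"
    unfolding S_def by (rule tendsto_arcosh) simp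
  then have "(s \<longlongrightarrow> S) at_top"
    by (rule Lim_transform_eventually) (use ev(1) in \<open>auto elim!: eventually_mono simp: arcosh_cosh_real\<close>)
  from tendsto_diff[OF ys this] have "(y \<longlongrightarrow> - S) at_top" by simp
  then have "((\<lambda>R. arctan (sinh (y R))) \<longlongrightarrow> arctan (sinh (- S))) at_top"
    by (intro tendsto_intros)
  then have "((\<lambda>R. branch_theta n R (R - 1 / R)) \<longlongrightarrow> arctan (sinh (- S))) at_top"
    using ev(4) by (rule Lim_transform_eventually)
  \<comment> \<open>The limit angle has cosine 1 / cosh S = exp (-1/2), so it equals -arccos (exp
    (-1/2)).\<close>
  moreover have "arctan (sinh (- S)) < 0"
    using arcosh_real_gt_1_iff[of "exp (1 / 2)"] by (simp add: S_def)
  \<comment> \<open>This membership certifies that \<open>branch_theta\<close> and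
    \<open>branch_graph\<close> are evaluated at an actual point of the curve and not at an
    arbitrary default of the inverse.\<close>
  moreover have "\<forall>\<^sub>F R in at_top. R - 1 / R \<in> branch_radii n R"
    using large by eventually_elim (use at(1) in auto)
  moreover have "\<forall>\<^sub>F R in at_top. 1 / cosh 4 / R \<le> branch_graph n R (R - 1 / R) \<and>
      branch_graph n R (R - 1 / R) \<le> 4 / R"
    using large by eventually_elim (use at(2,3) in auto)
  moreover have "(0 :: real) < 1 / cosh 4" "(0 :: real) < 4" by simp_all
  ultimately show ?thesis by blast
qed

end
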